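(* Let $P_1,\dots,P_n$ be discrete probability measures on $\mathbb{R}^d$ and let $\lambda\in\mathbb{R}^n$ be a strictly positive weight vector with $\sum_{i=1}^n\lambda_i=1$, and suppose the data is in general position. Then, among all partitions of $\{1,\dots,|S^*|\}$ into two sets $(S^* )^w$ and $(S^* )^y$, choosing $(S^* )^w=\{1,\dots,|S^*|\}$ and $(S^* )^y=\emptyset$ gives a minimal number of variables and a minimal number of constraints in LP (hybrid). For this choice, LP (hybrid) and LP (general) are identical.
   Context: Discrete measures: each $P_i$ is a probability measure on $\mathbb{R}^d$ with finite support $\mathrm{supp}(P_i)=\{\mathbf{x}_{ij} : j=1,\dots,|P_i|\}$ (distinct points; $|P_i|$ denotes the number of support points), with mass $d_{ij}>0$ at $\mathbf{x}_{ij}$ and $\sum_{j=1}^{|P_i|}d_{ij}=1$. Weighted means and tuples: $S^*=\mathrm{supp}(P_1)\times\dots\times\mathrm{supp}(P_n)=\{s^*_1,\dots,s^*_{|S^*|}\}$. For $s^*_h=(\mathbf{x}_{1j_1},\dots,\mathbf{x}_{nj_n})$ let $\mathbf{m}_h=\sum_{i=1}^n\lambda_i\mathbf{x}_{ij_i}$ be its weighted mean and $c_h=\sum_{i=1}^n\lambda_i\|\mathbf{m}_h-\mathbf{x}_{ij_i}\|^2$ its cost. $S=\{\mathbf{m}_h : h\le|S^*|\}=\{\mathbf{x}_1,\dots,\mathbf{x}_{|S|}\}$ (distinct elements). The data is in general position if different tuples in $S^*$ always have different weighted means, i.e. $|S|=|S^*|=\prod_{i=1}^n|P_i|$. LP (general),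 in variables $w_h$ ($h\le|S^*|$): minimize $\sum_{h=1}^{|S^*|}c_hw_h$ subject to $\sum_{h\in S^*_{ij}}w_h=d_{ij}$ for all $i\le n$, $j\le|P_i|$, and $w_h\ge0$ for all $h$, where $S^*_{ij}$ is the set of $h$ such that the $i$-th component of $s^*_h$ is $\mathbf{x}_{ij}$. LP (hybrid), for a partition of $\{1,\dots,|S^*|\}$ into $(S^* )^w$ and $(S^* )^y$: let $(S^* )^w_{ij}=S^*_{ij}\cap(S^* )^w$; let $S^y_{ij}$ be the set of $k$ such that $\mathbf{x}_k=\mathbf{m}_h$ for some $h\in(S^* )^y\cap S^*_{ij}$; let $S^y_k$ be the set of pairs $(i,j)$ with $k\in S^y_{ij}$; let $K^y=\bigcup_{i,j}S^y_{ij}$. The variables are $w_h$ ($h\in(S^* )^w$), $y_{ijk}$ ($i\le n$, $j\le|P_i|$, $k\in S^y_{ij}$) and $z_k$ ($k\in K^y$). Minimize $\sum_{h\in(S^* )^w}c_hw_h+\sum_{i=1}^n\lambda_i\sum_{j=1}^{|P_i|}\sum_{k\in S^y_{ij}}\|\mathbf{x}_k-\mathbf{x}_{ij}\|^2y_{ijk}$ subject to $\sum_{j:(i,j)\in S^y_k}y_{ijk}=z_k$ for all $i\le n$, $k\in K^y$; $\sum_{h\in(S^* )^w_{ij}}w_h+\sum_{k\in S^y_{ij}}y_{ijk}=d_{ij}$ for all $i\le n$, $j\le|P_i|$; $w_h\ge0$ for all $h\in(S^* )^w$; $y_{ijk}\ge0$ for all $i\le n$, $j\le|P_i|$, $k\in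 S^y_{ij}$. The number of constraints of an LP refers to the number of its equality constraints (nonnegativity of variables is not counted). *)

theory Defs
  imports "HOL-Probability.Probability_Mass_Function" "HOL-Analysis.Analysis"
begin

text \<open>
  Data of a linear minimization problem: objective coefficients, coefficient matrix and right-hand
  side of the equality constraints, and the set of variables required to be nonnegative.
  Equality constraints are labelled, so two constraints with the same coefficients and the same
  right-hand side still count twice.  Coefficients are meaningful only on
  \<open>lp_vars\<close> and \<open>lp_eqs\<close>.
\<close>

record ('v, 'c) lp =
  lp_vars :: "'v set"
  lp_obj :: "'v \<Rightarrow> real"
  lp_eqs :: "'c set"
  lp_mat :: "'c \<Rightarrow> 'v \<Rightarrow> real"
  lp_rhs :: "'c \<Rightarrow> real"
  lp_nonneg :: "'v set"

definition num_variables :: "('v, 'c) lp \<Rightarrow> nat" where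
  "num_variables L = card (lp_vars L)"

definition num_constraints :: "('v, 'c) lp \<Rightarrow> nat" where
  "num_constraints L = card (lp_eqs L)"

definition lp_identical :: "('v, 'c) lp \<Rightarrow> ('v, 'c) lp \<Rightarrow> bool" where
  "lp_identical L M \<longleftrightarrow>
     lp_vars L = lp_vars M \<and>
     (\<forall>v\<in>lp_vars L. lp_obj L v = lp_obj M v) \<and>
     lp_eqs L = lp_eqs M \<and>
     (\<forall>e\<in>lp_eqs L. \<forall>v\<in>lp_vars L. lp_mat L e v = lp_mat M e v) \<and>
     (\<forall>e\<in>lp_eqs L. lp_rhs L e = lp_rhs M e) \<and>
     lp_nonneg L = lp_nonneg M"

text \<open>
  Parameters used throughout: \<open>P 1, \<dots>, P n\<close> are the measures, \<open>l\<close> the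
  weights, \<open>x i j\<close> the \<open>j\<close>-th support point of \<open>P i\<close>,
  \<open>s h\<close> the \<open>h\<close>-th tuple of \<open>tuples n P\<close>, and \<open>p k\<close> the
  \<open>k\<close>-th point of \<open>means n P l\<close>.  All enumerations start at 1.
\<close>

definition supp_size :: "(nat \<Rightarrow> 'a pmf) \<Rightarrow> nat \<Rightarrow> nat" where
  "supp_size P i = card (set_pmf (P i))"

definition tuples :: "nat \<Rightarrow> (nat \<Rightarrow> 'a pmf) \<Rightarrow> (nat \<Rightarrow> 'a) set" where
  "tuples n P = (\<Pi>\<^sub>E i\<in>{1..n}. set_pmf (P i))"

definition wmean :: "nat \<Rightarrow> (nat \<Rightarrow> real) \<Rightarrow> (nat \<Rightarrow> real ^ 'd) \<Rightarrow> real ^ 'd" where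
  "wmean n l t = (\<Sum>i=1..n. l i *\<^sub>R t i)"

definition cost :: "nat \<Rightarrow> (nat \<Rightarrow> real) \<Rightarrow> (nat \<Rightarrow> real ^ 'd) \<Rightarrow> real" where
  "cost n l t = (\<Sum>i=1..n. l i * (norm (wmean n l t - t i))\<^sup>2)"

definition means :: "nat \<Rightarrow> (nat \<Rightarrow> (real ^ 'd) pmf) \<Rightarrow> (nat \<Rightarrow> real) \<Rightarrow> (real ^ 'd) set" where
  "means n P l = wmean n l ` tuples n P"

definition general_position :: "nat \<Rightarrow> (nat \<Rightarrow> (real ^ 'd) pmf) \<Rightarrow> (nat \<Rightarrow> real) \<Rightarrow> bool" where
  "general_position n P l \<longleftrightarrow> inj_on (wmean n l) (tuples n P)"

definition tuple_idx :: "nat \<Rightarrow> (nat \<Rightarrow> 'a pmf) \<Rightarrow> nat set" where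
  "tuple_idx n P = {1..card (tuples n P)}"

definition supp_idx :: "nat \<Rightarrow> (nat \<Rightarrow> 'a pmf) \<Rightarrow> (nat \<times> nat) set" where
  "supp_idx n P = (SIGMA i:{1..n}. {1..supp_size P i})"

text \<open>The sets \<open>S\<^sup>*\<^sub>i\<^sub>j\<close>, \<open>S\<^sup>y\<^sub>i\<^sub>j\<close>, \<open>S\<^sup>y\<^sub>k\<close> and \<open>K\<^sup>y\<close>;
  \<open>Hy\<close> is the set \<open>(S\<^sup>*)\<^sup>y\<close> of tuple indices.\<close>

definition S_star_ij ::
  "nat \<Rightarrow> (nat \<Rightarrow> 'a pmf) \<Rightarrow> (nat \<Rightarrow> nat \<Rightarrow> 'a) \<Rightarrow> (nat \<Rightarrow> nat \<Rightarrow> 'a) \<Rightarrow> nat \<Rightarrow> nat \<Rightarrow> nat set" where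
  "S_star_ij n P x s i j = {h \<in> tuple_idx n P. s h i = x i j}"

definition S_y_ij ::
  "nat \<Rightarrow> (nat \<Rightarrow> (real ^ 'd) pmf) \<Rightarrow> (nat \<Rightarrow> real) \<Rightarrow> (nat \<Rightarrow> nat \<Rightarrow> real ^ 'd) \<Rightarrow>
   (nat \<Rightarrow> nat \<Rightarrow> real ^ 'd) \<Rightarrow> (nat \<Rightarrow> real ^ 'd) \<Rightarrow> nat set \<Rightarrow> nat \<Rightarrow> nat \<Rightarrow> nat set" where
  "S_y_ij n P l x s p Hy i j =
     {k \<in> {1..card (means n P l)}. \<exists>h \<in> Hy \<inter> S_star_ij n P x s i j. p k = wmean n l (s h)}"

definition S_y_k ::
  "nat \<Rightarrow> (nat \<Rightarrow> (real ^ 'd) pmf) \<Rightarrow> (nat \<Rightarrow> real) \<Rightarrow> (nat \<Rightarrow> nat \<Rightarrow> real ^ 'd) \<Rightarrow>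
   (nat \<Rightarrow> nat \<Rightarrow> real ^ 'd) \<Rightarrow> (nat \<Rightarrow> real ^ 'd) \<Rightarrow> nat set \<Rightarrow> nat \<Rightarrow> (nat \<times> nat) set" where
  "S_y_k n P l x s p Hy k = {(i, j) \<in> supp_idx n P. k \<in> S_y_ij n P l x s p Hy i j}"

definition K_y ::
  "nat \<Rightarrow> (nat \<Rightarrow> (real ^ 'd) pmf) \<Rightarrow> (nat \<Rightarrow> real) \<Rightarrow> (nat \<Rightarrow> nat \<Rightarrow> real ^ 'd) \<Rightarrow>
   (nat \<Rightarrow> nat \<Rightarrow> real ^ 'd) \<Rightarrow> (nat \<Rightarrow> real ^ 'd) \<Rightarrow> nat set \<Rightarrow> nat set" where
  "K_y n P l x s p Hy = (\<Union>(i, j)\<in>supp_idx n P. S_y_ij n P l x s p Hy i j)"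

datatype lp_var = W nat | Y nat nat nat | Z nat

text \<open>\<open>Mass i j\<close> is the constraint with right-hand side \<open>d\<^sub>i\<^sub>j\<close>;
  \<open>Link i k\<close> is \<open>\<Sum>\<^sub>j y\<^sub>i\<^sub>j\<^sub>k = z\<^sub>k\<close>, written with
  \<open>z\<^sub>k\<close> moved to the left-hand side.\<close>

datatype lp_con = Mass nat nat | Link nat nat

text \<open>Only the variables \<open>W h\<close> and the constraints \<open>Mass i j\<close> occur in
  the general problem; the values given for the other constructors are immaterial.\<close>

definition lp_general ::
  "nat \<Rightarrow> (nat \<Rightarrow> (real ^ 'd) pmf) \<Rightarrow> (nat \<Rightarrow> real) \<Rightarrow> (nat \<Rightarrow> nat \<Rightarrow> real ^ 'd) \<Rightarrow>
   (nat \<Rightarrow> nat \<Rightarrow> real ^ 'd) \<Rightarrow> (lp_var, lp_con) lp" where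
  "lp_general n P l x s = \<lparr>
     lp_vars = W ` tuple_idx n P,
     lp_obj = (\<lambda>v. case v of W h \<Rightarrow> cost n l (s h) | _ \<Rightarrow> 0),
     lp_eqs = {Mass i j | i j. (i, j) \<in> supp_idx n P},
     lp_mat = (\<lambda>e v. case (e, v) of
         (Mass i j, W h) \<Rightarrow> of_bool (h \<in> S_star_ij n P x s i j)
       | _ \<Rightarrow> 0),
     lp_rhs = (\<lambda>e. case e of Mass i j \<Rightarrow> pmf (P i) (x i j) | _ \<Rightarrow> 0),
     lp_nonneg = W ` tuple_idx n P \<rparr>"

definition lp_hybrid ::
  "nat \<Rightarrow> (nat \<Rightarrow> (real ^ 'd) pmf) \<Rightarrow> (nat \<Rightarrow> real) \<Rightarrow> (nat \<Rightarrow> nat \<Rightarrow> real ^ 'd) \<Rightarrow>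
   (nat \<Rightarrow> nat \<Rightarrow> real ^ 'd) \<Rightarrow> (nat \<Rightarrow> real ^ 'd) \<Rightarrow> nat set \<Rightarrow> nat set \<Rightarrow> (lp_var, lp_con) lp" where
  "lp_hybrid n P l x s p Hw Hy = \<lparr>
     lp_vars = W ` Hw
       \<union> {Y i j k | i j k. (i, j) \<in> supp_idx n P \<and> k \<in> S_y_ij n P l x s p Hy i j}
       \<union> Z ` K_y n P l x s p Hy,
     lp_obj = (\<lambda>v. case v of
         W h \<Rightarrow> cost n l (s h)
       | Y i j k \<Rightarrow> l i * (norm (p k - x i j))\<^sup>2
       | Z k \<Rightarrow> 0),
     lp_eqs = {Link i k | i k. i \<in> {1..n} \<and> k \<in> K_y n P l x s p Hy}
       \<union> {Mass i j | i j. (i, j) \<in> supp_idx n P},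
     lp_mat = (\<lambda>e v. case (e, v) of
         (Link i k, W h) \<Rightarrow> 0
       | (Link i k, Y i' j' k') \<Rightarrow>
           of_bool (i' = i \<and> k' = k \<and> (i, j') \<in> S_y_k n P l x s p Hy k)
       | (Link i k, Z k') \<Rightarrow> - of_bool (k' = k)
       | (Mass i j, W h) \<Rightarrow> of_bool (h \<in> S_star_ij n P x s i j \<inter> Hw)
       | (Mass i j, Y i' j' k') \<Rightarrow>
           of_bool (i' = i \<and> j' = j \<and> k' \<in> S_y_ij n P l x s p Hy i j)
       | (Mass i j, Z k') \<Rightarrow> 0),
     lp_rhs = (\<lambda>e. case e of Link i k \<Rightarrow> 0 | Mass i j \<Rightarrow> pmf (P i) (x i j)),
     lp_nonneg = W ` Hw
       \<union> {Y i j k | i j k. (i, j) \<in> supp_idx n P \<and> k \<in> S_y_ij n P l x s p Hy i j} \<rparr>"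

end

theory Submission
  imports Defs
begin

text \<open>
  A tuple index \<open>h\<close> in \<open>(S\<^sup>*)\<^sup>w\<close> contributes its own variable
  \<open>w\<^sub>h\<close>.  In general position distinct indices \<open>h\<close> in
  \<open>(S\<^sup>*)\<^sup>y\<close> have distinct weighted means, so each of them is charged to its own
  variable \<open>z\<^sub>k\<close>; hence there are always at least \<open>|S\<^sup>*|\<close> variables, and
  the choice without \<open>y\<close> and \<open>z\<close> attains this number.  For the constraints, the
  mass constraints are present for every partition and are the only ones when \<open>K\<^sup>y\<close> is empty.
\<close>

lemma S_y_ij_empty [simp]: "S_y_ij n P l x s p {} i j = {}"
  by (simp add: S_y_ij_def)

lemma K_y_empty [simp]: "K_y n P l x s p {} = {}"
  by (simp add: K_y_def)

lemma finite_tuple_idx [simp]: "finite (tuple_idx n P)"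
  by (simp add: tuple_idx_def)

lemma finite_supp_idx [simp]: "finite (supp_idx n P)"
  by (simp add: supp_idx_def)

lemma finite_S_y_ij [simp]: "finite (S_y_ij n P l x s p Hy i j)"
  by (simp add: S_y_ij_def)

lemma finite_K_y [simp]: "finite (K_y n P l x s p Hy)"
  by (auto simp: K_y_def)

text \<open>\<open>card\<close> is 0 on infinite sets, so the counts can be bounded below only once
  the sets counted are known to be finite.\<close>

lemma finite_lp_vars_hybrid:
  assumes "finite Hw"
  shows "finite (lp_vars (lp_hybrid n P l x s p Hw Hy))"
proof -
  \<comment> \<open>The range of \<open>k\<close> depends on \<open>(i, j)\<close>; enlarging it to
    \<open>K_y\<close> gives the image of a finite product.\<close>
  have "{Y i j k | i j k. (i, j) \<in> supp_idx n P \<and> k \<in> S_y_ij n P l x s p Hy i j}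
      \<subseteq> (\<lambda>((i, j), k). Y i j k) ` (supp_idx n P \<times> K_y n P l x s p Hy)"
    by (force simp: K_y_def image_iff)
  then have "finite {Y i j k | i j k. (i, j) \<in> supp_idx n P \<and> k \<in> S_y_ij n P l x s p Hy i j}"
    by (rule finite_subset) simp
  then show ?thesis
    using assms by (simp add: lp_hybrid_def)
qed

lemma finite_lp_eqs_hybrid: "finite (lp_eqs (lp_hybrid n P l x s p Hw Hy))"
proof -
  have "{Link i k | i k. i \<in> {1..n} \<and> k \<in> K_y n P l x s p Hy} =
      (\<lambda>(i, k). Link i k) ` ({1..n} \<times> K_y n P l x s p Hy)"
    "{Mass i j | i j. (i, j) \<in> supp_idx n P} = (\<lambda>(i, j). Mass i j) ` supp_idx n P"
    by auto
  then show ?thesis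
    by (simp add: lp_hybrid_def)
qed

lemma num_variables_hybrid_all_W:
  "num_variables (lp_hybrid n P l x s p (tuple_idx n P) {}) = card (tuple_idx n P)"
  by (simp add: num_variables_def lp_hybrid_def card_image inj_on_def)

text \<open>The labels in \<open>lp_eqs\<close> depend on the partition only through
  \<open>Hy\<close>, hence the arbitrary \<open>H\<close>.\<close>

lemma num_constraints_hybrid_all_W_le:
  "num_constraints (lp_hybrid n P l x s p H {}) \<le> num_constraints (lp_hybrid n P l x s p Hw Hy)"
  unfolding num_constraints_def
  by (rule card_mono[OF finite_lp_eqs_hybrid]) (auto simp: lp_hybrid_def)

text \<open>Only variables \<open>W h\<close> with \<open>h\<close> in \<open>tuple_idx n P\<close>
  remain, so intersecting \<open>S_star_ij\<close> with that set changes no coefficient.\<close>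

lemma lp_identical_hybrid_all_W:
  "lp_identical (lp_hybrid n P l x s p (tuple_idx n P) {}) (lp_general n P l x s)"
  by (auto simp: lp_identical_def lp_hybrid_def lp_general_def)

lemma obtain_K_y_idx:
  assumes "n \<ge> 1"
    and supp: "\<And>i. i \<in> {1..n} \<Longrightarrow> bij_betw (x i) {1..supp_size P i} (set_pmf (P i))"
    and tup: "bij_betw s (tuple_idx n P) (tuples n P)"
    and means: "bij_betw p {1..card (means n P l)} (means n P l)"
    and h: "h \<in> Hy" "h \<in> tuple_idx n P"
  obtains k where "k \<in> K_y n P l x s p Hy" "p k = wmean n l (s h)"
proof -
  have sh: "s h \<in> tuples n P"
    using tup h(2) by (rule bij_betwE[THEN bspec])
  then have "wmean n l (s h) \<in> p ` {1..card (means n P l)}"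
    using means by (simp add: means_def bij_betw_imp_surj_on)
  then obtain k where k: "k \<in> {1..card (means n P l)}" "p k = wmean n l (s h)"
    by (metis imageE)
  \<comment> \<open>Any coordinate of the tuple would place \<open>k\<close> in some
    \<open>S_y_ij\<close>; the first one is used. For \<open>n = 0\<close> there is none, and
    \<open>K_y\<close> is empty.\<close>
  have 1: "1 \<in> {1..n}"
    using \<open>n \<ge> 1\<close> by simp
  then have "s h 1 \<in> x 1 ` {1..supp_size P 1}"
    using sh supp[OF 1] by (auto simp: tuples_def bij_betw_imp_surj_on)
  then obtain j where j: "j \<in> {1..supp_size P 1}" "s h 1 = x 1 j"
    by blast
  then have "(1, j) \<in> supp_idx n P"
    using 1 by (simp add: supp_idx_def)
  moreover have "k \<in> S_y_ij n P l x s p Hy 1 j"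
    using k j h by (auto simp: S_y_ij_def S_star_ij_def)
  ultimately show thesis
    using that k(2) by (fastforce simp: K_y_def)
qed

lemma card_tuple_idx_le_num_variables_hybrid:
  assumes "n \<ge> 1"
    and supp: "\<And>i. i \<in> {1..n} \<Longrightarrow> bij_betw (x i) {1..supp_size P i} (set_pmf (P i))"
    and tup: "bij_betw s (tuple_idx n P) (tuples n P)"
    and means: "bij_betw p {1..card (means n P l)} (means n P l)"
    and gen: "general_position n P l"
    and part: "Hw \<union> Hy = tuple_idx n P"
  shows "card (tuple_idx n P) \<le> num_variables (lp_hybrid n P l x s p Hw Hy)"
proof -
  have "\<exists>k. k \<in> K_y n P l x s p Hy \<and> p k = wmean n l (s h)" if "h \<in> Hy" for h
    using obtain_K_y_idx[OF assms(1) supp tup means that] that part by (metis UnCI)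
  then obtain \<kappa> where \<kappa>:
    "\<And>h. h \<in> Hy \<Longrightarrow> \<kappa> h \<in> K_y n P l x s p Hy \<and> p (\<kappa> h) = wmean n l (s h)"
    by metis
  have "inj_on (wmean n l \<circ> s) (tuple_idx n P)"
    using gen tup by (auto simp: general_position_def bij_betw_def intro: comp_inj_on)
  \<comment> \<open>If \<open>\<kappa>\<close> agrees at two indices, applying \<open>p\<close>
    shows that their weighted means agree, so general position identifies the indices.\<close>
  then have inj_\<kappa>: "inj_on \<kappa> Hy"
    using \<kappa> part by (intro inj_onI) (metis UnCI comp_apply inj_onD)
  \<comment> \<open>An index outside \<open>Hw\<close> lies in \<open>Hy\<close>, where
    \<open>\<kappa>\<close> is specified; distinct constructors keep the two branches apart.\<close>
  let ?f = "\<lambda>h. if h \<in> Hw then W h else Z (\<kappa> h)"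
  have "inj_on ?f (tuple_idx n P)"
    using inj_\<kappa> part by (auto simp: inj_on_def)
  moreover have "?f ` tuple_idx n P \<subseteq> lp_vars (lp_hybrid n P l x s p Hw Hy)"
    using \<kappa> part by (auto simp: lp_hybrid_def)
  moreover have "finite Hw"
    using part finite_tuple_idx by (metis finite_Un)
  ultimately show ?thesis
    unfolding num_variables_def by (intro card_inj_on_le finite_lp_vars_hybrid)
qed

theorem theorem5:
  fixes n :: nat
    and P :: "nat \<Rightarrow> (real ^ 'd) pmf"
    and l :: "nat \<Rightarrow> real"
    and x :: "nat \<Rightarrow> nat \<Rightarrow> real ^ 'd"
    and s :: "nat \<Rightarrow> nat \<Rightarrow> real ^ 'd"
    and p :: "nat \<Rightarrow> real ^ 'd"
  assumes finite_supp: "\<And>i. i \<in> {1..n} \<Longrightarrow> finite (set_pmf (P i))"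
    and weights_pos: "\<And>i. i \<in> {1..n} \<Longrightarrow> l i > 0"
    and weights_sum: "(\<Sum>i=1..n. l i) = 1"
    and enum_supp: "\<And>i. i \<in> {1..n} \<Longrightarrow> bij_betw (x i) {1..supp_size P i} (set_pmf (P i))"
    and enum_tuples: "bij_betw s (tuple_idx n P) (tuples n P)"
    and enum_means: "bij_betw p {1..card (means n P l)} (means n P l)"
    and general_pos: "general_position n P l"
  shows "(\<forall>Hw Hy. Hw \<union> Hy = tuple_idx n P \<and> Hw \<inter> Hy = {} \<longrightarrow>
            num_variables (lp_hybrid n P l x s p (tuple_idx n P) {})
              \<le> num_variables (lp_hybrid n P l x s p Hw Hy) \<and>
            num_constraints (lp_hybrid n P l x s p (tuple_idx n P) {})
              \<le> num_constraints (lp_hybrid n P l x s p Hw Hy)) \<and>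
         lp_identical (lp_hybrid n P l x s p (tuple_idx n P) {}) (lp_general n P l x s)"
proof -
  \<comment> \<open>For \<open>n = 0\<close> the weights would sum to 0 instead of 1.\<close>
  have "n \<ge> 1"
    using weights_sum by (cases n) auto
  then show ?thesis
    using card_tuple_idx_le_num_variables_hybrid[OF _ enum_supp enum_tuples enum_means general_pos]
    by (auto simp: num_variables_hybrid_all_W num_constraints_hybrid_all_W_le
        lp_identical_hybrid_all_W)
qed

end
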